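(* Define functions on $x>-1$ by $f_0(x)=\ln(1+x)$ and $f_n(x)=\int_0^x f_{n-1}(t)\,dt$ for $n\ge 1$, and let $A_n(x)$ be the polynomial such that $f_n(x) = -xA_n(x) + \frac{(1+x)^n}{n!}\ln(1+x)$. Then for every $n \ge 0$, $$A_n(x)=\frac{1}{n!}\sum_{k=0}^{n}\binom{n}{k}x^k\sum_{m=1}^{n-k}\frac{(-x)^{m-1}}{m}.$$
   Context: Sums whose upper limit is smaller than the lower limit are empty (equal to $0$). *)

theory Defs
  imports "HOL-Analysis.Analysis" "HOL-Computational_Algebra.Polynomial"
begin

text \<open>
  The values of these functions are meaningful only for \<open>x > -1\<close>. The interval integral
  is oriented, so for \<open>-1 < x < 0\<close> it is minus the integral over \<open>(x, 0)\<close>; in either case the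
  integrand is evaluated only at points greater than \<open>-1\<close>.
\<close>
primrec iter_ln :: "nat \<Rightarrow> real \<Rightarrow> real" where
  "iter_ln 0 = (\<lambda>x. ln (1 + x))"
| "iter_ln (Suc n) = (\<lambda>x. LBINT t=ereal 0..ereal x. iter_ln n t)"

definition is_A :: "nat \<Rightarrow> real poly \<Rightarrow> bool" where
  "is_A n p \<longleftrightarrow>
     (\<forall>x>-1. iter_ln n x = - x * poly p x + (1 + x) ^ n / fact n * ln (1 + x))"

definition A :: "nat \<Rightarrow> real poly" where
  "A n = (THE p. is_A n p)"

end

theory Submission
  imports Defs
begin

text \<open>
  With \<open>L = ln (1 + x)\<close>, expanding \<open>(1 + x)^n\<close> by the binomial theorem turns the claim into
  \<open>n! f\<^sub>n = G\<^sub>n\<close>, where \<open>G\<^sub>n = (\<Sum>k\<le>n. (n choose k) x^k (L + (\<Sum>m=1..n-k. (-x)^m / m)))\<close>.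
  The inner bracket is the Taylor remainder of \<open>L\<close> and has derivative \<open>(-x)^(n-k) / (1 + x)\<close>.
  In \<open>G\<^sub>n\<^sub>+\<^sub>1'\<close> these derivatives contribute \<open>x^(n+1) (1 - 1)^(n+1) / (1 + x) = 0\<close>, while
  differentiating the powers \<open>x^k\<close> gives \<open>(n + 1) G\<^sub>n\<close>. Hence \<open>G\<^sub>n / n!\<close> satisfies the recursion
  that defines \<open>f\<^sub>n\<close>.
\<close>

definition ln_remainder :: "nat \<Rightarrow> real \<Rightarrow> real" where
  "ln_remainder j x = ln (1 + x) + (\<Sum>m=1..j. (-x) ^ m / real m)"

definition binomial_ln :: "nat \<Rightarrow> real \<Rightarrow> real" where
  "binomial_ln n x = (\<Sum>k\<le>n. real (n choose k) * x ^ k * ln_remainder (n - k) x)"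

text \<open>The claimed formula as a formal polynomial, so that it can be a witness for
  \<open>is_A\<close>; \<open>[:0, -1:]\<close> stands for -x.\<close>

definition A_sum :: "nat \<Rightarrow> real poly" where
  "A_sum n = smult (1 / fact n) (\<Sum>k=0..n. monom (real (n choose k)) k *
     (\<Sum>m=1..n-k. smult (1 / real m) ([:0, -1:] ^ (m - 1))))"

lemma poly_A_sum:
  "poly (A_sum n) x = 1 / fact n * (\<Sum>k=0..n. real (n choose k) * x ^ k *
     (\<Sum>m=1..n-k. (- x) ^ (m - 1) / real m))"
  by (simp add: A_sum_def poly_sum poly_monom poly_power)

text \<open>Differentiating the sum subtracts the first j terms of the geometric series of 1 / (1 +
  x), so only its tail is left.\<close>

lemma has_derivative_ln_remainder:
  assumes "x > -1"
  shows "(ln_remainder j has_real_derivative (-x) ^ j / (1 + x)) (at x)"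
proof (induction j)
  case 0
  show ?case
    unfolding ln_remainder_def using assms by (auto intro!: derivative_eq_intros)
next
  case (Suc j)
  have "ln_remainder (Suc j) = (\<lambda>y. ln_remainder j y + (-y) ^ Suc j / real (Suc j))"
    by (simp add: ln_remainder_def fun_eq_iff)
  moreover have "((\<lambda>y. (-y) ^ Suc j / real (Suc j)) has_real_derivative - ((-x) ^ j)) (at x)"
    by (rule derivative_eq_intros refl | simp del: of_nat_Suc)+
  moreover have "(-x) ^ j / (1 + x) - (-x) ^ j = (-x) ^ Suc j / (1 + x)"
    using assms by (simp add: field_simps)
  ultimately show ?case
    using DERIV_add[OF Suc.IH] by fastforce
qed

lemma has_derivative_binomial_ln:
  assumes "x > -1"
  shows "(binomial_ln (Suc n) has_real_derivative real (Suc n) * binomial_ln n x) (at x)"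
proof -
  let ?N = "Suc n"
  have "(binomial_ln ?N has_real_derivative
      (\<Sum>k\<le>?N. real (?N choose k) * (real k * x ^ (k - 1)) * ln_remainder (?N - k) x
        + real (?N choose k) * x ^ k * ((-x) ^ (?N - k) / (1 + x)))) (at x)"
    unfolding binomial_ln_def
    by (rule derivative_eq_intros has_derivative_ln_remainder[OF assms] refl | simp add: mult_ac)+
  moreover have "(\<Sum>k\<le>?N. real (?N choose k) * (real k * x ^ (k - 1)) * ln_remainder (?N - k) x)
      = real ?N * binomial_ln n x"
  proof -
    have absorb: "real (?N choose Suc k) * real (Suc k) = real ?N * real (n choose k)" for k
      by (metis Suc_times_binomial mult.commute of_nat_mult)
    have shift: "real (?N choose Suc k) * (real (Suc k) * x ^ k) * r
        = real ?N * (real (n choose k) * x ^ k * r)" for k r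
      using arg_cong[OF absorb[of k], of "\<lambda>c. c * (x ^ k * r)"] by (simp only: mult.assoc)
    \<comment> \<open>The term k = 0 vanishes through its factor \<open>real k\<close>, so the sum
      can start at 1 and be reindexed before \<open>absorb\<close> applies.\<close>
    show ?thesis
      unfolding binomial_ln_def sum_distrib_left
      by (subst sum.atMost_Suc_shift)
        (simp del: of_nat_Suc binomial_Suc_Suc, rule sum.cong[OF refl shift])
  qed
  \<comment> \<open>It matters that the exponent \<open>?N\<close> of x + (-x) is positive, since 0
    ^ 0 = 1.\<close>
  moreover have "(\<Sum>k\<le>?N. real (?N choose k) * x ^ k * ((-x) ^ (?N - k) / (1 + x))) = 0"
    using binomial_ring[of x "-x" ?N]
    by (simp add: sum_divide_distrib[symmetric] del: binomial_Suc_Suc)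
  ultimately show ?thesis
    by (simp only: sum.distrib add_0_right)
qed

text \<open>Fixes the constant of integration, as the iterated integrals start at 0.\<close>

lemma binomial_ln_0 [simp]: "binomial_ln n 0 = 0"
proof -
  have "ln_remainder j 0 = 0" for j
    by (auto simp: ln_remainder_def intro!: sum.neutral)
  then show ?thesis by (simp add: binomial_ln_def)
qed

lemma iter_ln_eq_binomial_ln:
  assumes "x > -1"
  shows "iter_ln n x = binomial_ln n x / fact n"
  using assms
proof (induction n arbitrary: x)
  case 0
  show ?case by (simp add: binomial_ln_def ln_remainder_def)
next
  case (Suc n)
  \<comment> \<open>The segment between 0 and x, for either sign of x.\<close>
  let ?I = "{min 0 x..max 0 x}"
  let ?F = "\<lambda>t. binomial_ln (Suc n) t / fact (Suc n)"
  have dom: "t > -1" if "t \<in> ?I" for t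
    using that Suc.prems by (auto simp: min_def split: if_splits)
  have "isCont (binomial_ln n) t" if "t > -1" for t
    unfolding binomial_ln_def using that
    by (intro continuous_intros DERIV_isCont[OF has_derivative_ln_remainder])
  then have "continuous_on ?I (\<lambda>t. binomial_ln n t / fact n)"
    using dom by (intro continuous_at_imp_continuous_on ballI continuous_intros) auto
  \<comment> \<open>Continuity passes over from the closed form, which is known to agree with
    \<open>iter_ln n\<close> only beyond -1; \<open>dom\<close> keeps \<open>?I\<close>
    there.\<close>
  then have cont: "continuous_on ?I (iter_ln n)"
    by (rule continuous_on_eq) (use Suc.IH dom in auto)
  have "(?F has_real_derivative iter_ln n t) (at t)" if "t > -1" for t
    using DERIV_cdivide[OF has_derivative_binomial_ln[OF that, of n], of "fact (Suc n)"] Suc.IH[OF that]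
    by (simp del: of_nat_Suc)
  then have "(?F has_vector_derivative iter_ln n t) (at t within ?I)" if "t \<in> ?I" for t
    using dom[OF that]
    by (metis has_real_derivative_iff_has_vector_derivative has_vector_derivative_at_within)
  then have "(LBINT t=ereal 0..ereal x. iter_ln n t) = ?F x - ?F 0"
    by (intro interval_integral_FTC_finite cont) auto
  then show ?case by simp
qed

lemma binomial_ln_eq_A_sum:
  "binomial_ln n x / fact n = - x * poly (A_sum n) x + (1 + x) ^ n / fact n * ln (1 + x)"
proof -
  \<comment> \<open>Since m starts at 1, a factor -x splits off each term; it becomes the -x in
    front of the polynomial.\<close>
  have "(\<Sum>m=1..j. (-x) ^ m / real m) = - x * (\<Sum>m=1..j. (-x) ^ (m - 1) / real m)" for j
    unfolding sum_distrib_left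
    by (rule sum.cong) (auto simp: power_eq_if)
  then have "binomial_ln n x = (\<Sum>k\<le>n. real (n choose k) * x ^ k) * ln (1 + x)
      - x * (\<Sum>k\<le>n. real (n choose k) * x ^ k * (\<Sum>m=1..n-k. (- x) ^ (m - 1) / real m))"
    unfolding binomial_ln_def ln_remainder_def
    by (simp add: sum_distrib_left sum_distrib_right sum.distrib[symmetric]
        sum_subtractf[symmetric] sum_negf algebra_simps)
  also have "(\<Sum>k\<le>n. real (n choose k) * x ^ k) = (1 + x) ^ n"
    using binomial_ring[of x 1 n] by (simp add: add.commute)
  finally show ?thesis
    by (simp add: poly_A_sum atLeast0AtMost field_simps)
qed

lemma is_A_A_sum: "is_A n (A_sum n)"
  by (simp add: is_A_def iter_ln_eq_binomial_ln binomial_ln_eq_A_sum)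

text \<open>The equation in \<open>is_A\<close> can be solved for the value of the polynomial
  wherever x > -1 and x is nonzero. Hence p - q has infinitely many roots; the interval (0, 1)
  supplies enough.\<close>

lemma is_A_unique:
  assumes "is_A n p" "is_A n q"
  shows "p = q"
proof (rule ccontr)
  assume "p \<noteq> q"
  then have "finite {x. poly (p - q) x = 0}"
    by (intro poly_roots_finite) simp
  moreover have "{0<..<1} \<subseteq> {x. poly (p - q) x = 0}"
  proof
    fix x :: real assume "x \<in> {0<..<1}"
    then have "x > -1" "x \<noteq> 0" by auto
    then have "- x * poly p x = - x * poly q x"
      using assms[unfolded is_A_def, rule_format, of x] by linarith
    with \<open>x \<noteq> 0\<close> show "x \<in> {x. poly (p - q) x = 0}" by simp
  qed
  ultimately have "finite {0<..<1::real}"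
    by (rule finite_subset[rotated])
  then show False
    using infinite_Ioo[of "0::real" 1] by simp
qed

theorem theorem2p3:
  fixes n :: nat
  shows "(\<exists>!p. is_A n p) \<and>
    (\<forall>x::real. poly (A n) x =
      1 / fact n * (\<Sum>k=0..n. real (n choose k) * x ^ k *
        (\<Sum>m=1..n-k. (- x) ^ (m - 1) / real m)))"
proof -
  have ex1: "\<exists>!p. is_A n p"
    by (rule ex1I[where a = "A_sum n"]) (rule is_A_A_sum is_A_unique | assumption)+
  have "A n = A_sum n"
    unfolding A_def by (rule the1_equality[OF ex1 is_A_A_sum])
  with ex1 show ?thesis
    by (simp only: poly_A_sum) simp
qed

end
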